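(* Let assumption (A) of the context hold for the iterates of the variance-reduced heavy-ball SGD algorithm $$x_{k+1}=x_k-\alpha(\nabla f(x_k)+w_{k,N_k})+\beta(x_k-x_{k-1}),\qquad k\ge0,\quad x_{-1}=x_0,$$ where $\beta\in(0,1)$, $\alpha\in\big(0,\tfrac{2(1-\beta)}{L+\eta}\big)$, and $N_k=\lceil(k+1)^v\rceil$ with $v>0$. Then there exists a constant $C(v)>0$ such that $$\mathbb E[\|x_k-x^*\|^2]\le C(v)\,(k+1)^{-v}\qquad\forall k\ge0.$$
   Context: Problem: minimize $f(x)=\mathbb E[F(x,\boldsymbol\xi)]$ over $x\in\mathbb R^m$, where $\boldsymbol\xi$ is an $\mathbb R^d$-valued random vector and $F:\mathbb R^m\times\mathbb R^d\to\mathbb R$ ($f$ need not be quadratic). Sampled gradients $\nabla F(x,\xi)$ (gradient in $x$) are available. The algorithm starts from $x_0\in\mathbb R^m$ with positive integers $N_k$ (batch sizes); $\xi_{j,k}$ ($1\le j\le N_k$, $k\ge 0$) are i.i.d. copies of $\boldsymbol\xi$; $w_{k,N_k}=\frac1{N_k}\sum_{j=1}^{N_k}\nabla F(x_k,\xi_{j,k})-\nabla f(x_k)$; and $\mathcal F_k=\sigma\{x_0,\xi_{j,t}:1\le j\le N_t,\,0\le t\le k-1\}$, so $x_k$ is $\mathcal F_k$-measurable. Assumption (A): (i) $f$ is continuously differentiable on $\mathbb R^m$ and $\|\nabla f(x)-\nabla f(x')\|\le L\|x-x'\|$ for all $x,x'$, with $L>0$; (ii) $f$ is $\eta$-strongly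 convex, $\eta>0$: $(\nabla f(x)-\nabla f(x'))^T(x-x')\ge\eta\|x-x'\|^2$ for all $x,x'$; (iii) there is $\nu>0$ such that for all $k\ge0$ and $1\le j\le N_k$, almost surely $\mathbb E[\nabla F(x_k,\xi_{j,k})\mid\mathcal F_k]=\nabla f(x_k)$ and $\mathbb E[\|\nabla F(x_k,\xi_{j,k})-\nabla f(x_k)\|^2\mid\mathcal F_k]\le\nu^2$. The unique minimizer of $f$ is denoted $x^*$. *)

theory Defs
  imports "HOL-Probability.Probability"
begin

definition gradient :: "('a::real_inner \<Rightarrow> real) \<Rightarrow> 'a \<Rightarrow> 'a" where
  "gradient f x = (THE D. GDERIV f x :> D)"

definition vec_cond_exp ::
  "'w measure \<Rightarrow> 'w measure \<Rightarrow> ('w \<Rightarrow> real ^ 'm) \<Rightarrow> 'w \<Rightarrow> real ^ 'm" where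
  "vec_cond_exp M G X \<omega> = (\<chi> i. real_cond_exp M G (\<lambda>\<omega>'. X \<omega>' $ i) \<omega>)"

text \<open>In \<open>\<xi> j t\<close>, \<open>j\<close> is the position in the batch and \<open>t\<close> the iteration.\<close>

definition history ::
  "'w measure \<Rightarrow> ('w \<Rightarrow> 'a::topological_space) \<Rightarrow> (nat \<Rightarrow> nat \<Rightarrow> 'w \<Rightarrow> 'b::topological_space) \<Rightarrow>
    (nat \<Rightarrow> nat) \<Rightarrow> nat \<Rightarrow> 'w measure" where
  "history M X0 \<xi> N k = sigma (space M)
     ({X0 -` B \<inter> space M | B. B \<in> sets borel} \<union>
      {\<xi> j t -` B \<inter> space M | j t B. j \<in> {1..N t} \<and> t < k \<and> B \<in> sets borel})"

lemma gradient_eqI: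
  assumes "GDERIV f x :> D"
  shows "gradient f x = D"
proof -
  have "D' = D" if "GDERIV f x :> D'" for D'
  proof -
    have "(\<lambda>h. h \<bullet> D') = (\<lambda>h. h \<bullet> D)"
      using that assms unfolding gderiv_def by (rule has_derivative_unique)
    then have "h \<bullet> D' = h \<bullet> D" for h
      by (rule fun_cong)
    then show ?thesis
      by (rule vector_eq_ldot[THEN iffD1, OF allI])
  qed
  with assms show ?thesis
    unfolding gradient_def by (intro the_equality)
qed

lemma GDERIV_gradient:
  fixes f :: "'a::euclidean_space \<Rightarrow> real"
  assumes "f differentiable (at x)"
  shows "GDERIV f x :> gradient f x"
proof -
  from assms obtain f' where f': "(f has_derivative f') (at x)"
    by (auto simp: differentiable_def)
  then interpret f': bounded_linear f'
    by (rule has_derivative_bounded_linear)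
  have "f' = (\<lambda>h. h \<bullet> (adjoint f' 1))"
    using adjoint_works[OF f'.linear_axioms] by (simp add: fun_eq_iff)
  with f' have "GDERIV f x :> adjoint f' 1"
    by (simp add: gderiv_def)
  with gradient_eqI[OF this] show ?thesis
    by simp
qed

end

theory Submission
  imports Defs "HOL-Real_Asymp.Real_Asymp"
begin

text \<open>
  For a suitable \<open>c > 0\<close>, the Lyapunov function
  \<open>V\<^sub>k = f x\<^sub>k - f x\<^sup>* + c \<parallel>x\<^sub>k - x\<^sub>k\<^sub>-\<^sub>1\<parallel>\<^sup>2\<close> satisfies
  \<open>V\<^sub>k\<^sub>+\<^sub>1 \<le> q V\<^sub>k + K \<parallel>w\<^sub>k\<parallel>\<^sup>2\<close> with \<open>q < 1\<close> on every path: solve the recursion for the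
  gradient, insert it into the descent lemma, and absorb the noise by Young's inequality.
  Unbiasedness and independence enter only through \<open>E \<parallel>w\<^sub>k\<parallel>\<^sup>2 \<le> \<nu>\<^sup>2 / N\<^sub>k\<close>, that is, through
  the vanishing of the covariances within a batch.
  A contraction perturbed by \<open>O ((k + 1) powr (- v))\<close> decays at the rate of the perturbation.
\<close>

section \<open>The Lyapunov function\<close>

lemma has_real_derivative_along_line:
  fixes f :: "'a::euclidean_space \<Rightarrow> real"
  assumes "\<And>y. f differentiable (at y)"
  shows "((\<lambda>t. f (y + t *\<^sub>R d)) has_real_derivative gradient f (y + t *\<^sub>R d) \<bullet> d) (at t)"
proof -
  have "(f has_derivative (\<lambda>h. h \<bullet> gradient f (y + t *\<^sub>R d))) (at (y + t *\<^sub>R d))"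
    using GDERIV_gradient[OF assms] by (simp add: gderiv_def)
  moreover have "((\<lambda>t. y + t *\<^sub>R d) has_derivative (\<lambda>s. s *\<^sub>R d)) (at t)"
    by (auto intro!: derivative_eq_intros)
  ultimately have "((\<lambda>t. f (y + t *\<^sub>R d)) has_derivative
      (\<lambda>s. (s *\<^sub>R d) \<bullet> gradient f (y + t *\<^sub>R d))) (at t)"
    by (rule has_derivative_compose[rotated])
  then show ?thesis
    by (rule has_derivative_imp_has_field_derivative) (simp add: inner_commute)
qed

text \<open>Along the segment, \<open>f\<close> minus the claimed upper model has nonpositive
  derivative on [0, 1], by Cauchy-Schwarz and the Lipschitz bound; comparing the endpoints
  finishes.\<close>

lemma descent_lemma:
  fixes f :: "'a::euclidean_space \<Rightarrow> real"
  assumes diff: "\<And>y. f differentiable (at y)"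
    and lip: "\<And>y y'. norm (gradient f y - gradient f y') \<le> L * norm (y - y')"
  shows "f (y + d) \<le> f y + gradient f y \<bullet> d + L / 2 * (norm d)\<^sup>2"
proof -
  define \<phi> where "\<phi> t = f (y + t *\<^sub>R d) - t * (gradient f y \<bullet> d) - L / 2 * t\<^sup>2 * (norm d)\<^sup>2" for t
  have "\<phi> 1 \<le> \<phi> 0"
  proof (rule DERIV_nonpos_imp_nonincreasing[where f = \<phi>])
    fix t :: real assume t: "0 \<le> t" "t \<le> 1"
    let ?D = "gradient f (y + t *\<^sub>R d) \<bullet> d - gradient f y \<bullet> d - L * t * (norm d)\<^sup>2"
    have "(\<phi> has_real_derivative ?D) (at t)"
      unfolding \<phi>_def
      by (auto intro!: derivative_eq_intros has_real_derivative_along_line[OF diff])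
    moreover have "?D \<le> 0"
    proof -
      have "(gradient f (y + t *\<^sub>R d) - gradient f y) \<bullet> d
          \<le> norm (gradient f (y + t *\<^sub>R d) - gradient f y) * norm d"
        by (rule norm_cauchy_schwarz)
      also have "\<dots> \<le> (L * norm (t *\<^sub>R d)) * norm d"
        using lip[of "y + t *\<^sub>R d" y] by (intro mult_right_mono) auto
      also have "\<dots> = L * t * (norm d)\<^sup>2"
        using t by (simp add: power2_eq_square)
      finally show ?thesis by (simp add: inner_diff_left)
    qed
    ultimately show "\<exists>D. (\<phi> has_real_derivative D) (at t) \<and> D \<le> 0" by blast
  qed simp
  then show ?thesis by (simp add: \<phi>_def)
qed

lemma gradient_minimizer_eq_0:
  fixes f :: "'a::euclidean_space \<Rightarrow> real"
  assumes "f differentiable (at x)" and "\<And>y. f x \<le> f y"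
  shows "gradient f x = 0"
proof -
  have "(f has_derivative (\<lambda>h. h \<bullet> gradient f x)) (at x)"
    using GDERIV_gradient[OF assms(1)] by (simp add: gderiv_def)
  then have "(\<lambda>h. h \<bullet> gradient f x) = (\<lambda>h. 0)"
    by (rule has_derivative_local_min) (simp add: assms(2))
  then have "gradient f x \<bullet> gradient f x = 0"
    by (rule fun_cong)
  then show ?thesis by simp
qed

text \<open>Mirror image of the descent lemma: the deviation from the lower model is nondecreasing
  along the segment.\<close>

lemma strongly_monotone_gradient_lower_bound:
  fixes f :: "'a::euclidean_space \<Rightarrow> real"
  assumes diff: "\<And>y. f differentiable (at y)"
    and mono: "\<And>y y'. (gradient f y - gradient f y') \<bullet> (y - y') \<ge> \<eta> * (norm (y - y'))\<^sup>2"
  shows "f (y + d) \<ge> f y + gradient f y \<bullet> d + \<eta> / 2 * (norm d)\<^sup>2"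
proof -
  define \<phi> where "\<phi> t = f (y + t *\<^sub>R d) - t * (gradient f y \<bullet> d) - \<eta> / 2 * t\<^sup>2 * (norm d)\<^sup>2" for t
  have "\<phi> 0 \<le> \<phi> 1"
  proof (rule DERIV_nonneg_imp_nondecreasing[where f = \<phi>])
    fix t :: real assume t: "0 \<le> t" "t \<le> 1"
    let ?D = "gradient f (y + t *\<^sub>R d) \<bullet> d - gradient f y \<bullet> d - \<eta> * t * (norm d)\<^sup>2"
    have "(\<phi> has_real_derivative ?D) (at t)"
      unfolding \<phi>_def
      by (auto intro!: derivative_eq_intros has_real_derivative_along_line[OF diff])
    moreover have "?D \<ge> 0"
    \<comment> \<open>\<open>mono\<close> bounds only t times the wanted quantity, so t has to be
      cancelled; at t = 0 the derivative is 0.\<close>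
    proof (cases "t = 0")
      case False
      have "\<eta> * (norm (t *\<^sub>R d))\<^sup>2 \<le> (gradient f (y + t *\<^sub>R d) - gradient f y) \<bullet> (t *\<^sub>R d)"
        using mono[of y "y + t *\<^sub>R d"] mono[of "y + t *\<^sub>R d" y] by simp
      then have "t * (\<eta> * t * (norm d)\<^sup>2) \<le> t * ((gradient f (y + t *\<^sub>R d) - gradient f y) \<bullet> d)"
        by (simp add: power_mult_distrib power2_eq_square mult_ac)
      then have "\<eta> * t * (norm d)\<^sup>2 \<le> (gradient f (y + t *\<^sub>R d) - gradient f y) \<bullet> d"
        using False t by (simp add: mult_le_cancel_left)
      then show ?thesis by (simp add: inner_diff_left)
    qed simp
    ultimately show "\<exists>D. (\<phi> has_real_derivative D) (at t) \<and> D \<ge> 0" by blast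
  qed simp
  then show ?thesis by (simp add: \<phi>_def)
qed

text \<open>The defect of the inequality is the sum of the squared pairwise differences.\<close>

lemma norm_add3_power2_le:
  fixes a b c :: "'a::real_inner"
  shows "(norm (a + b + c))\<^sup>2 \<le> 3 * ((norm a)\<^sup>2 + (norm b)\<^sup>2 + (norm c)\<^sup>2)"
proof -
  have "0 \<le> (norm (a - b))\<^sup>2 + (norm (b - c))\<^sup>2 + (norm (a - c))\<^sup>2"
    by simp
  then show ?thesis
    by (simp add: power2_norm_eq_inner algebra_simps inner_commute)
qed

text \<open>Here \<open>p\<close> is the previous increment, \<open>d\<close> the next one and
  \<open>e\<close> the noise. The descent lemma dissipates only the squared norms of
  \<open>p\<close> and \<open>d\<close>; the gap \<open>f y - f xs\<close> shrinks too, because it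
  is dominated by the gradient, which is a combination of \<open>p\<close>, \<open>d\<close> and
  \<open>e\<close>.\<close>

lemma heavy_ball_lyapunov_step:
  fixes f :: "'a::euclidean_space \<Rightarrow> real"
  assumes diff: "\<And>y. f differentiable (at y)"
    and L: "L > 0"
    and lip: "\<And>y y'. norm (gradient f y - gradient f y') \<le> L * norm (y - y')"
    and \<eta>: "\<eta> > 0"
    and mono: "\<And>y y'. (gradient f y - gradient f y') \<bullet> (y - y') \<ge> \<eta> * (norm (y - y'))\<^sup>2"
    and min: "\<And>y. f xs \<le> f y"
    and \<beta>: "0 < \<beta>" "\<beta> < 1"
    and \<alpha>: "0 < \<alpha>" "\<alpha> < 2 * (1 - \<beta>) / L"
  obtains c q K where "c > 0" "0 < q" "q < 1" "K \<ge> 0"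
    and "\<And>y p e d. d = \<beta> *\<^sub>R p - \<alpha> *\<^sub>R (gradient f y + e) \<Longrightarrow>
      f (y + d) - f xs + c * (norm d)\<^sup>2 \<le> q * (f y - f xs + c * (norm p)\<^sup>2) + K * (norm e)\<^sup>2"
proof -
  \<comment> \<open>\<open>4 * \<epsilon>\<close> is the slack in the step size condition. The term \<open>\<beta> / (2 * \<alpha>)\<close> of \<open>c\<close> makes the
    cross term \<open>(\<beta> / \<alpha>) * (p \<bullet> d)\<close> telescope.\<close>
  define \<epsilon> where "\<epsilon> = ((1 - \<beta>) / \<alpha> - L / 2) / 4"
  define c where "c = \<beta> / (2 * \<alpha>) + \<epsilon>"
  \<comment> \<open>\<open>\<delta>\<close> is the domination factor 2 \<eta>^2 / L times \<epsilon>
    \<alpha>^2 / 6, as \<open>dV\<close> requires. \<open>q\<close> uses the smaller of the decay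
    rates of the gap and of the increment term; the floor 1/2 keeps it positive. \<open>K\<close>
    adds the noise costs of Young's inequality and of the gradient bound.\<close>
  define \<delta> where "\<delta> = \<epsilon> * \<alpha>\<^sup>2 * \<eta>\<^sup>2 / (3 * L)"
  define q where "q = max (1 / 2) (1 - min (\<epsilon> / (2 * c)) \<delta>)"
  define K where "K = 1 / (4 * \<epsilon>) + \<epsilon> * \<alpha>\<^sup>2 / 2"
  have \<epsilon>: "\<epsilon> > 0"
    using \<alpha> L by (simp add: \<epsilon>_def field_simps)
  have c: "c > 0"
    using \<epsilon> \<beta> \<alpha> by (simp add: c_def add_pos_pos)
  have \<delta>: "\<delta> > 0"
    using \<epsilon> \<alpha> \<eta> L by (simp add: \<delta>_def)
  have "f (y + d) - f xs + c * (norm d)\<^sup>2 \<le> q * (f y - f xs + c * (norm p)\<^sup>2) + K * (norm e)\<^sup>2"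
    if d: "d = \<beta> *\<^sub>R p - \<alpha> *\<^sub>R (gradient f y + e)" for y p e d
  proof -
    define g where "g = gradient f y"
    define P D E Q V where "P = (norm p)\<^sup>2" and "D = (norm d)\<^sup>2" and "E = (norm e)\<^sup>2"
      and "Q = (norm g)\<^sup>2" and "V = f y - f xs"
    have nn: "P \<ge> 0" "D \<ge> 0" "E \<ge> 0" "Q \<ge> 0" "V \<ge> 0"
      using min by (simp_all add: P_def D_def E_def Q_def V_def)
    have gs: "gradient f xs = 0"
      using diff min by (rule gradient_minimizer_eq_0)
    \<comment> \<open>Gradient domination: the gap is at most quadratic in the distance to the
      minimizer, and strong monotonicity bounds that distance by the norm of the gradient.\<close>
    have "V \<le> L / 2 * (norm (y - xs))\<^sup>2"
      using descent_lemma[OF diff lip, of xs "y - xs"] gs by (simp add: V_def)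
    moreover have "\<eta> * norm (y - xs) \<le> norm g"
    proof (cases "y = xs")
      case False
      have "\<eta> * (norm (y - xs))\<^sup>2 \<le> g \<bullet> (y - xs)"
        using mono[where y = y and y' = xs] gs by (simp add: g_def)
      also have "\<dots> \<le> norm g * norm (y - xs)"
        by (rule norm_cauchy_schwarz)
      finally show ?thesis
        using False by (simp add: power2_eq_square)
    qed simp
    then have "\<eta>\<^sup>2 * (norm (y - xs))\<^sup>2 \<le> Q"
      unfolding Q_def power_mult_distrib[symmetric] using \<eta> by (intro power_mono) auto
    moreover have "L / 2 * (norm (y - xs))\<^sup>2 * (2 * \<eta>\<^sup>2 / L) = \<eta>\<^sup>2 * (norm (y - xs))\<^sup>2"
      using L by simp
    ultimately have VQ: "V * (2 * \<eta>\<^sup>2 / L) \<le> Q"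
      using L mult_right_mono[of V "L / 2 * (norm (y - xs))\<^sup>2" "2 * \<eta>\<^sup>2 / L"]
      by (simp add: mult.commute)
    \<comment> \<open>The gradient is controlled by both increments and the noise, so dissipation of
      the increments can be spent on the gap.\<close>
    have "\<alpha> *\<^sub>R g = \<beta> *\<^sub>R p + (- d) + (- (\<alpha> *\<^sub>R e))"
      by (simp add: d g_def algebra_simps)
    then have "(norm (\<alpha> *\<^sub>R g))\<^sup>2 \<le> 3 * (\<beta>\<^sup>2 * P + D + \<alpha>\<^sup>2 * E)"
      using norm_add3_power2_le[of "\<beta> *\<^sub>R p" "- d" "- (\<alpha> *\<^sub>R e)"]
      by (simp add: P_def D_def E_def power_mult_distrib)
    moreover have "\<beta>\<^sup>2 * P \<le> 1 * P"
      using \<beta> nn by (intro mult_right_mono) (auto simp: power_le_one)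
    ultimately have Q: "\<alpha>\<^sup>2 * Q \<le> 3 * (P + D + \<alpha>\<^sup>2 * E)"
      by (simp add: Q_def power_mult_distrib)
    have "\<epsilon> / 2 * \<alpha>\<^sup>2 * (V * (2 * \<eta>\<^sup>2 / L)) / 3 \<le> \<epsilon> / 2 * \<alpha>\<^sup>2 * Q / 3"
      using VQ \<epsilon> by (intro divide_right_mono mult_left_mono) auto
    also have "\<dots> \<le> \<epsilon> / 2 * (P + D + \<alpha>\<^sup>2 * E)"
      using mult_left_mono[OF Q, of "\<epsilon> / 6"] \<epsilon> by (simp add: algebra_simps)
    finally have dV: "\<delta> * V \<le> \<epsilon> / 2 * (P + D + \<alpha>\<^sup>2 * E)"
      by (simp add: \<delta>_def field_simps)
    \<comment> \<open>Substituted into the first-order term of the descent lemma, this produces the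
      dissipation \<open>- D / \<alpha>\<close>.\<close>
    have "g = (1 / \<alpha>) *\<^sub>R (\<beta> *\<^sub>R p - d) - e"
      using \<alpha> by (simp add: d g_def scaleR_add_right)
    then have gd: "g \<bullet> d = (\<beta> * (p \<bullet> d) - D) / \<alpha> - e \<bullet> d"
      by (simp add: inner_diff_left inner_add_left D_def power2_norm_eq_inner)
    have "0 \<le> (norm (p - d))\<^sup>2" by simp
    then have pd: "p \<bullet> d \<le> (P + D) / 2"
      by (simp add: P_def D_def power2_norm_eq_inner algebra_simps inner_commute)
    \<comment> \<open>Young's inequality, weighted so that the noise costs exactly one
      \<open>\<epsilon> * D\<close>.\<close>
    have "0 \<le> (norm (e + (2 * \<epsilon>) *\<^sub>R d))\<^sup>2" by simp
    also have "\<dots> = E + 4 * \<epsilon> * (e \<bullet> d) + 4 * \<epsilon>\<^sup>2 * D"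
      unfolding E_def D_def power2_norm_eq_inner
      by (simp add: algebra_simps inner_commute power2_eq_square[of \<epsilon>])
    finally have ed: "- (e \<bullet> d) \<le> \<epsilon> * D + 1 / (4 * \<epsilon>) * E"
      using \<epsilon> by (simp add: field_simps power2_eq_square)
    have "\<beta> / \<alpha> * (p \<bullet> d) \<le> \<beta> / \<alpha> * ((P + D) / 2)"
      using pd \<alpha> \<beta> by (intro mult_left_mono) auto
    then have "g \<bullet> d \<le> \<beta> / (2 * \<alpha>) * (P + D) - D / \<alpha> + \<epsilon> * D + 1 / (4 * \<epsilon>) * E"
      using ed by (simp add: gd diff_divide_distrib)
    moreover have "f (y + d) \<le> f y + g \<bullet> d + L / 2 * D"
      using descent_lemma[OF diff lip] by (simp add: g_def D_def)
    \<comment> \<open>Of the slack \<open>4 * \<epsilon> * D\<close>, Young's inequality takes one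
      unit and the summand \<open>\<epsilon>\<close> of \<open>c\<close> another; two
      remain.\<close>
    moreover have "1 / \<alpha> = \<beta> / \<alpha> + (L / 2 + 4 * \<epsilon>)"
      by (simp add: \<epsilon>_def diff_divide_distrib)
    then have "D / \<alpha> = \<beta> / \<alpha> * D + (L / 2 + 4 * \<epsilon>) * D"
      by (metis distrib_right mult.commute mult_1 times_divide_eq_right)
    ultimately have "f (y + d) - f xs + c * D \<le> V + c * P - 2 * \<epsilon> * D - \<epsilon> * P + 1 / (4 * \<epsilon>) * E"
      by (simp add: V_def c_def algebra_simps add_divide_distrib)
    \<comment> \<open>The remaining dissipation is split: \<open>\<epsilon> / 2 * P\<close> shrinks
      the increment term, the rest pays for the gap through \<open>dV\<close>.\<close>
    moreover have "2 * \<epsilon> * D + \<epsilon> * P \<ge> \<epsilon> / 2 * P + \<delta> * V - \<epsilon> * \<alpha>\<^sup>2 / 2 * E"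
    proof -
      have "0 \<le> \<epsilon> * D" "0 \<le> \<epsilon> * P" using \<epsilon> nn by simp_all
      moreover have "\<epsilon> / 2 * (P + D + \<alpha>\<^sup>2 * E) = \<epsilon> * P / 2 + \<epsilon> * D / 2 + \<epsilon> * \<alpha>\<^sup>2 / 2 * E"
        by (simp add: algebra_simps)
      ultimately show ?thesis using dV by linarith
    qed
    ultimately have "f (y + d) - f xs + c * D \<le> (1 - \<delta>) * V + (c - \<epsilon> / 2) * P + K * E"
      by (simp add: K_def algebra_simps)
    also have "\<dots> \<le> q * V + q * (c * P) + K * E"
    proof (intro add_mono order_refl)
      show "(1 - \<delta>) * V \<le> q * V"
        using nn by (intro mult_right_mono) (auto simp: q_def)
      have "(1 - \<epsilon> / (2 * c)) * (c * P) \<le> q * (c * P)"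
        using nn c by (intro mult_right_mono) (auto simp: q_def)
      then show "(c - \<epsilon> / 2) * P \<le> q * (c * P)"
        using c by (simp add: algebra_simps)
    qed
    finally show ?thesis
      by (simp add: V_def P_def D_def E_def algebra_simps)
  qed
  moreover have "0 < q" "q < 1"
    using \<epsilon> c \<delta> by (auto simp: q_def)
  moreover have "K \<ge> 0"
    using \<epsilon> by (simp add: K_def)
  ultimately show ?thesis
    using that c by blast
qed

text \<open>The ratio of consecutive weights tends to 1, so eventually a step loses at most a factor
  \<open>R\<close> with \<open>q * R < 1\<close>, and induction closes. The finitely many earlier
  terms only enlarge \<open>C\<close>.\<close>

lemma contraction_powr_perturbation:
  fixes a :: "nat \<Rightarrow> real"
  assumes nonneg: "\<And>k. a k \<ge> 0" and q: "0 < q" "q < 1" and K: "K \<ge> 0"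
    and step: "\<And>k. a (Suc k) \<le> q * a k + K * (real k + 1) powr (- v)"
  obtains C where "C > 0" "\<And>k. a k \<le> C * (real k + 1) powr (- v)"
proof -
  \<comment> \<open>Chosen so that \<open>q * R\<close> is the midpoint of \<open>q\<close> and
    1.\<close>
  define R where "R = (1 + q) / (2 * q)"
  have R: "R > 1"
    using q by (simp add: R_def field_simps)
  have "((\<lambda>k. (real k + 1) powr (- v) / (real k + 2) powr (- v)) \<longlongrightarrow> 1) sequentially"
    by real_asymp
  then have "eventually (\<lambda>k. (real k + 1) powr (- v) / (real k + 2) powr (- v) < R) sequentially"
    using R by (rule order_tendstoD)
  then obtain m where m: "\<And>k. k \<ge> m \<Longrightarrow> (real k + 1) powr (- v) / (real k + 2) powr (- v) < R"
    by (auto simp: eventually_sequentially)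
  define S where "S = (\<Sum>k\<le>m. a k / (real k + 1) powr (- v))"
  \<comment> \<open>The summands serve the terms up to \<open>m\<close>, the induction step and
    positivity; the second solves \<open>(1 + q) / 2 * C + K * R = C\<close>.\<close>
  define C where "C = S + 2 * K * R / (1 - q) + 1"
  have S: "S \<ge> 0"
    unfolding S_def by (intro sum_nonneg) (simp add: nonneg)
  have KR: "2 * K * R / (1 - q) \<ge> 0"
    using K R q by simp
  have C: "C > 0" "S \<le> C" "2 * K * R / (1 - q) \<le> C"
    using S KR by (simp_all add: C_def)
  have small: "a k \<le> C * (real k + 1) powr (- v)" if "k \<le> m" for k
  proof -
    have "a k / (real k + 1) powr (- v) \<le> S"
      unfolding S_def using that nonneg
      by (intro member_le_sum) auto
    then have "a k / (real k + 1) powr (- v) \<le> C"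
      using C by linarith
    then show ?thesis
      by (simp add: pos_divide_le_eq)
  qed
  have "a k \<le> C * (real k + 1) powr (- v)" for k
  proof (induction k)
    case 0
    then show ?case using small[of 0] by simp
  next
    case (Suc k)
    show ?case
    proof (cases "Suc k \<le> m")
      \<comment> \<open>Now \<open>k \<ge> m\<close>, so the ratio bound holds at \<open>k\<close>
        itself.\<close>
      case False
      have "a (Suc k) \<le> q * (C * (real k + 1) powr (- v)) + K * (real k + 1) powr (- v)"
        using step[of k] mult_left_mono[OF Suc.IH, of q] q by linarith
      also have "\<dots> = (q * C + K) * (real k + 1) powr (- v)"
        by (simp add: algebra_simps)
      also have "\<dots> \<le> (q * C + K) * (R * (real k + 2) powr (- v))"
        using m[of k] False q C K
        by (intro mult_left_mono) (auto simp: pos_divide_less_eq intro!: less_imp_le)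
      also have "\<dots> = ((1 + q) / 2 * C + K * R) * (real k + 2) powr (- v)"
        using q by (simp add: R_def field_simps)
      also have "\<dots> \<le> C * (real k + 2) powr (- v)"
      proof (rule mult_right_mono)
        have "2 * (K * R) \<le> C * (1 - q)"
          using C(3) q by (simp add: pos_divide_le_eq)
        then show "(1 + q) / 2 * C + K * R \<le> C"
          by (simp add: field_simps)
      qed simp
      finally show ?thesis
        by (simp add: add.commute)
    qed (rule small)
  qed
  with C(1) that show ?thesis by blast
qed

section \<open>Measurability and second moments\<close>

text \<open>Inserting a simple function, which has finitely many values, in the first argument
  preserves measurability; continuity passes this to the limit.\<close>

lemma borel_measurable_caratheodory:
  fixes F :: "'a::{metric_space, second_countable_topology} \<Rightarrow> 'b \<Rightarrow> 'c::metric_space"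
  assumes meas: "\<And>y. F y \<in> borel_measurable S"
    and cont: "\<And>z. z \<in> space S \<Longrightarrow> continuous_on UNIV (\<lambda>u. F u z)"
  shows "(\<lambda>(y, z). F y z) \<in> borel_measurable (borel \<Otimes>\<^sub>M S)"
proof -
  obtain s :: "nat \<Rightarrow> 'a \<Rightarrow> 'a" where s: "\<And>i. simple_function borel (s i)"
    and lim: "\<And>y. (\<lambda>i. s i y) \<longlonglongrightarrow> y"
    using borel_measurable_implies_sequence_metric[of "\<lambda>y::'a. y" borel undefined] by auto
  show ?thesis
  proof (rule borel_measurable_LIMSEQ_metric)
    fix i
    have "s i \<in> borel \<rightarrow>\<^sub>M count_space (range (s i))"
      using s[of i] by (auto simp: simple_function_def measurable_count_space_eq2)
    then have "(\<lambda>p. s i (fst p)) \<in> borel \<Otimes>\<^sub>M S \<rightarrow>\<^sub>M count_space (range (s i))"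
      by (rule measurable_compose[OF measurable_fst])
    moreover have "countable (range (s i))"
      using s[of i] by (simp add: simple_function_def countable_finite)
    ultimately show "(\<lambda>p. F (s i (fst p)) (snd p)) \<in> borel_measurable (borel \<Otimes>\<^sub>M S)"
      by (intro measurable_compose_countable'[where f = "\<lambda>a p. F a (snd p)" and g = "\<lambda>p. s i (fst p)"]
          measurable_compose[OF measurable_snd] meas)
  next
    fix p :: "'a \<times> 'b" assume "p \<in> space (borel \<Otimes>\<^sub>M S)"
    then have "continuous_on UNIV (\<lambda>u. F u (snd p))"
      by (intro cont) (auto simp: space_pair_measure)
    then have "(\<lambda>i. F (s i (fst p)) (snd p)) \<longlonglongrightarrow> F (fst p) (snd p)"
      using lim by (rule continuous_on_tendsto_compose) auto
    then show "(\<lambda>i. F (s i (fst p)) (snd p)) \<longlonglongrightarrow> (case p of (y, z) \<Rightarrow> F y z)"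
      by (simp add: case_prod_beta)
  qed
qed

text \<open>Each coordinate is a pointwise limit of difference quotients, which the previous lemma
  makes jointly measurable. Joint measurability permits evaluating the gradient at a random
  point.\<close>

lemma borel_measurable_gradient:
  fixes F :: "'a::euclidean_space \<Rightarrow> 'b \<Rightarrow> real"
  assumes meas: "\<And>y. F y \<in> borel_measurable S"
    and diff: "\<And>y z. z \<in> space S \<Longrightarrow> (\<lambda>u. F u z) differentiable (at y)"
  shows "(\<lambda>(y, z). gradient (\<lambda>u. F u z) y) \<in> borel_measurable (borel \<Otimes>\<^sub>M S)"
proof -
  have F: "(\<lambda>(y, z). F y z) \<in> borel_measurable (borel \<Otimes>\<^sub>M S)"
    by (intro borel_measurable_caratheodory[OF meas] continuous_at_imp_continuous_on ballI
        differentiable_imp_continuous_within diff)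
  have F_shift: "(\<lambda>p. F (fst p + v) (snd p)) \<in> borel_measurable (borel \<Otimes>\<^sub>M S)" for v
  proof -
    have "(\<lambda>p. (fst p + v, snd p)) \<in> borel \<Otimes>\<^sub>M S \<rightarrow>\<^sub>M borel \<Otimes>\<^sub>M S"
      by measurable
    from measurable_compose[OF this F] show ?thesis by (simp only: prod.case)
  qed
  show ?thesis
  proof (rule borel_measurable_euclidean_space[THEN iffD2], rule ballI)
    fix b :: 'a
    let ?h = "\<lambda>i. inverse (real (Suc i))"
    show "(\<lambda>p. (case p of (y, z) \<Rightarrow> gradient (\<lambda>u. F u z) y) \<bullet> b) \<in> borel_measurable (borel \<Otimes>\<^sub>M S)"
    proof (rule borel_measurable_LIMSEQ_metric)
      fix i
      \<comment> \<open>The summand 0 makes the second term an instance of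
        \<open>F_shift\<close>.\<close>
      show "(\<lambda>p. (F (fst p + ?h i *\<^sub>R b) (snd p) - F (fst p + 0) (snd p)) / ?h i)
          \<in> borel_measurable (borel \<Otimes>\<^sub>M S)"
        by (intro borel_measurable_divide borel_measurable_diff F_shift borel_measurable_const)
    next
      fix p :: "'a \<times> 'b" assume "p \<in> space (borel \<Otimes>\<^sub>M S)"
      then have "snd p \<in> space S"
        by (auto simp: space_pair_measure)
      then have "((\<lambda>t. F (fst p + t *\<^sub>R b) (snd p)) has_real_derivative
          gradient (\<lambda>u. F u (snd p)) (fst p + 0 *\<^sub>R b) \<bullet> b) (at 0)"
        using has_real_derivative_along_line[where f = "\<lambda>u. F u (snd p)"] diff by blast
      then have "((\<lambda>t. (F (fst p + t *\<^sub>R b) (snd p) - F (fst p) (snd p)) / t)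
          \<longlongrightarrow> gradient (\<lambda>u. F u (snd p)) (fst p) \<bullet> b) (at 0)"
        by (simp add: DERIV_def)
      moreover have "filterlim ?h (at 0) sequentially"
        by (intro filterlim_atI LIMSEQ_inverse_real_of_nat) auto
      ultimately show "(\<lambda>i. (F (fst p + ?h i *\<^sub>R b) (snd p) - F (fst p + 0) (snd p)) / ?h i)
          \<longlonglongrightarrow> (case p of (y, z) \<Rightarrow> gradient (\<lambda>u. F u z) y) \<bullet> b"
        unfolding case_prod_beta add_0_right by (rule filterlim_compose)
    qed
  qed
qed

text \<open>
  By Fubini, \<open>m x = E (h (x, Y))\<close> integrates to \<open>0\<close> over every set under the law of \<open>\<phi> W\<close>, so it vanishes
  almost everywhere.
\<close>
lemma (in prob_space) expectation_mult_centered_indep: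
  fixes h :: "'s \<times> 't \<Rightarrow> real"
  assumes ind: "indep_var R W T Y"
    and \<phi> [measurable]: "\<phi> \<in> R \<rightarrow>\<^sub>M S"
    and h [measurable]: "h \<in> borel_measurable (S \<Otimes>\<^sub>M T)"
    and int: "integrable M (\<lambda>\<omega>. h (\<phi> (W \<omega>), Y \<omega>))"
    and centered: "\<And>B. B \<in> sets S \<Longrightarrow> expectation (\<lambda>\<omega>. indicator B (\<phi> (W \<omega>)) * h (\<phi> (W \<omega>), Y \<omega>)) = 0"
    and l [measurable]: "l \<in> borel_measurable R"
    and int_l: "integrable M (\<lambda>\<omega>. l (W \<omega>) * h (\<phi> (W \<omega>), Y \<omega>))"
  shows "expectation (\<lambda>\<omega>. l (W \<omega>) * h (\<phi> (W \<omega>), Y \<omega>)) = 0"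
proof -
  have W [measurable]: "W \<in> M \<rightarrow>\<^sub>M R" and Y [measurable]: "Y \<in> M \<rightarrow>\<^sub>M T"
    and D: "distr M R W \<Otimes>\<^sub>M distr M T Y = distr M (R \<Otimes>\<^sub>M T) (\<lambda>\<omega>. (W \<omega>, Y \<omega>))"
    using ind by (auto simp: indep_var_distribution_eq)
  let ?P = "distr M R W" and ?Q = "distr M T Y"
  interpret P: prob_space ?P by (rule prob_space_distr) simp
  interpret Q: prob_space ?Q by (rule prob_space_distr) simp
  interpret PQ: pair_sigma_finite ?P ?Q ..
  define m where "m x = (\<integral>y. h (x, y) \<partial>?Q)" for x
  have m [measurable]: "m \<in> borel_measurable S"
    unfolding m_def by measurable
  \<comment> \<open>Stated for a general weight: it is applied with the constant 1, with indicators
    of events of \<open>\<phi> (W \<omega>)\<close>, and with \<open>l\<close>.\<close>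
  have fub: "expectation (\<lambda>\<omega>. l' (W \<omega>) * h (\<phi> (W \<omega>), Y \<omega>)) = (\<integral>a. l' a * m (\<phi> a) \<partial>?P)"
    and fub_int: "integrable ?P (\<lambda>a. l' a * m (\<phi> a))"
    if [measurable]: "l' \<in> borel_measurable R"
      and i: "integrable M (\<lambda>\<omega>. l' (W \<omega>) * h (\<phi> (W \<omega>), Y \<omega>))" for l'
  proof -
    let ?k = "\<lambda>p. l' (fst p) * h (\<phi> (fst p), snd p)"
    have "integrable (?P \<Otimes>\<^sub>M ?Q) ?k"
      unfolding D using i by (subst integrable_distr_eq) auto
    from PQ.integrable_fst'[OF this] PQ.integral_fst'[OF this]
    show "expectation (\<lambda>\<omega>. l' (W \<omega>) * h (\<phi> (W \<omega>), Y \<omega>)) = (\<integral>a. l' a * m (\<phi> a) \<partial>?P)"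
      and "integrable ?P (\<lambda>a. l' a * m (\<phi> a))"
      unfolding D by (simp_all add: m_def integral_distr)
  qed
  let ?X = "distr ?P S \<phi>"
  have "integrable ?X m"
    using fub_int[of "\<lambda>_. 1"] int by (subst integrable_distr_eq) auto
  moreover have "(\<integral>x\<in>B. m x \<partial>?X) = (\<integral>x\<in>B. 0 \<partial>?X)" if "B \<in> sets ?X" for B
  proof -
    from that have B [measurable]: "B \<in> sets S" by simp
    have "integrable M (\<lambda>\<omega>. indicator B (\<phi> (W \<omega>)) * h (\<phi> (W \<omega>), Y \<omega>))"
      by (rule Bochner_Integration.integrable_bound[OF int]) (auto simp: indicator_def)
    then have "(\<integral>a. indicator B (\<phi> a) * m (\<phi> a) \<partial>?P) = 0"
      using fub[of "\<lambda>a. indicator B (\<phi> a)"] centered[OF B] by simp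
    then show ?thesis
      by (simp add: set_lebesgue_integral_def integral_distr)
  qed
  ultimately have "AE x in ?X. m x = 0"
    by (intro density_unique_real) auto
  then have "AE a in ?P. m (\<phi> a) = 0"
    by (subst (asm) AE_distr_iff) auto
  then have "(\<integral>a. l a * m (\<phi> a) \<partial>?P) = 0"
    by (intro integral_eq_zero_AE) auto
  with fub[OF l int_l] show ?thesis by simp
qed

section \<open>Square-integrable random vectors\<close>

definition square_integrable :: "'w measure \<Rightarrow> ('w \<Rightarrow> 'a::euclidean_space) \<Rightarrow> bool" where
  "square_integrable M u \<longleftrightarrow> u \<in> borel_measurable M \<and> integrable M (\<lambda>\<omega>. (norm (u \<omega>))\<^sup>2)"

lemma square_integrable_bound:
  assumes u: "square_integrable M u" and v: "v \<in> borel_measurable M"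
    and le: "\<And>\<omega>. \<omega> \<in> space M \<Longrightarrow> norm (v \<omega>) \<le> C * norm (u \<omega>)"
  shows "square_integrable M v"
proof -
  have "integrable M (\<lambda>\<omega>. C\<^sup>2 * (norm (u \<omega>))\<^sup>2)"
    using u by (simp add: square_integrable_def)
  then have "integrable M (\<lambda>\<omega>. (norm (v \<omega>))\<^sup>2)"
  proof (rule Bochner_Integration.integrable_bound)
    show "AE \<omega> in M. norm ((norm (v \<omega>))\<^sup>2) \<le> norm (C\<^sup>2 * (norm (u \<omega>))\<^sup>2)"
      using power_mono[OF le norm_ge_zero, of _ 2] by (auto simp: power_mult_distrib intro!: AE_I2)
  qed (use v in auto)
  with v show ?thesis by (simp add: square_integrable_def)
qed

lemma square_integrable_scaleR:
  assumes "square_integrable M u"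
  shows "square_integrable M (\<lambda>\<omega>. c *\<^sub>R u \<omega>)"
proof (rule square_integrable_bound[OF assms, where C = "\<bar>c\<bar>"])
  show "(\<lambda>\<omega>. c *\<^sub>R u \<omega>) \<in> borel_measurable M"
    using assms by (intro borel_measurable_scaleR borel_measurable_const) (simp add: square_integrable_def)
qed simp

lemma integrable_inner_square_integrable:
  fixes u v :: "'w \<Rightarrow> 'a::euclidean_space"
  assumes u: "square_integrable M u" and v: "square_integrable M v"
  shows "integrable M (\<lambda>\<omega>. u \<omega> \<bullet> v \<omega>)"
proof (rule Bochner_Integration.integrable_bound)
  show "integrable M (\<lambda>\<omega>. (norm (u \<omega>))\<^sup>2 + (norm (v \<omega>))\<^sup>2)"
    using u v by (simp add: square_integrable_def)
  have "\<bar>u \<omega> \<bullet> v \<omega>\<bar> \<le> (norm (u \<omega>))\<^sup>2 + (norm (v \<omega>))\<^sup>2" for \<omega>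
    using Cauchy_Schwarz_ineq2[of "u \<omega>" "v \<omega>"] sum_squares_bound[of "norm (u \<omega>)" "norm (v \<omega>)"]
      mult_nonneg_nonneg[OF norm_ge_zero norm_ge_zero, of "u \<omega>" "v \<omega>"] by linarith
  then show "AE \<omega> in M. norm (u \<omega> \<bullet> v \<omega>) \<le> norm ((norm (u \<omega>))\<^sup>2 + (norm (v \<omega>))\<^sup>2)"
    by (intro AE_I2) simp
qed (use u v in \<open>auto simp: square_integrable_def\<close>)

lemma square_integrable_add:
  assumes u: "square_integrable M u" and v: "square_integrable M v"
  shows "square_integrable M (\<lambda>\<omega>. u \<omega> + v \<omega>)"
proof -
  have "integrable M (\<lambda>\<omega>. (norm (u \<omega>))\<^sup>2 + 2 * (u \<omega> \<bullet> v \<omega>) + (norm (v \<omega>))\<^sup>2)"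
    using u v integrable_inner_square_integrable[OF u v] by (simp add: square_integrable_def)
  moreover have "(norm (u \<omega>))\<^sup>2 + 2 * (u \<omega> \<bullet> v \<omega>) + (norm (v \<omega>))\<^sup>2 = (norm (u \<omega> + v \<omega>))\<^sup>2" for \<omega>
    by (simp add: power2_norm_eq_inner algebra_simps inner_commute)
  ultimately show ?thesis
    using u v by (simp add: square_integrable_def borel_measurable_add)
qed

lemma square_integrable_diff:
  assumes u: "square_integrable M u" and v: "square_integrable M v"
  shows "square_integrable M (\<lambda>\<omega>. u \<omega> - v \<omega>)"
  using square_integrable_add[OF u square_integrable_scaleR[OF v, of "-1"]] by simp

lemma square_integrable_sum:
  assumes "\<And>j. j \<in> J \<Longrightarrow> square_integrable M (u j)"
  shows "square_integrable M (\<lambda>\<omega>. \<Sum>j\<in>J. u j \<omega>)"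
proof (cases "finite J")
  case True
  then show ?thesis
    using assms by (induction J) (auto intro: square_integrable_add simp: square_integrable_def[of M "\<lambda>_. 0"])
qed (simp add: square_integrable_def)

lemma (in finite_measure) square_integrable_const: "square_integrable M (\<lambda>_. c)"
  by (simp add: square_integrable_def)

lemma (in finite_measure) square_integrable_integrable_inner:
  "square_integrable M u \<Longrightarrow> integrable M (\<lambda>\<omega>. u \<omega> \<bullet> b)"
  by (rule integrable_inner_square_integrable[OF _ square_integrable_const])

text \<open>Orthogonality removes the mixed terms of the expanded square; the n diagonal terms,
  scaled by 1/n^2, leave s/n.\<close>

lemma second_moment_average_le:
  fixes u :: "'i \<Rightarrow> 'w \<Rightarrow> 'a::euclidean_space"
  assumes J: "finite J" "J \<noteq> {}"
    and sq: "\<And>j. j \<in> J \<Longrightarrow> square_integrable M (u j)"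
    and le: "\<And>j. j \<in> J \<Longrightarrow> (\<integral>\<omega>. (norm (u j \<omega>))\<^sup>2 \<partial>M) \<le> s"
    and orth: "\<And>i j. i \<in> J \<Longrightarrow> j \<in> J \<Longrightarrow> i \<noteq> j \<Longrightarrow> (\<integral>\<omega>. u i \<omega> \<bullet> u j \<omega> \<partial>M) = 0"
  shows "(\<integral>\<omega>. (norm ((1 / real (card J)) *\<^sub>R (\<Sum>j\<in>J. u j \<omega>)))\<^sup>2 \<partial>M) \<le> s / real (card J)"
proof -
  let ?n = "real (card J)"
  have n: "?n > 0" using J by (simp add: card_gt_0_iff)
  have "(\<integral>\<omega>. (norm (\<Sum>j\<in>J. u j \<omega>))\<^sup>2 \<partial>M) = (\<integral>\<omega>. (\<Sum>i\<in>J. \<Sum>j\<in>J. u i \<omega> \<bullet> u j \<omega>) \<partial>M)"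
    by (simp add: power2_norm_eq_inner inner_sum_left inner_sum_right inner_commute)
  also have "\<dots> = (\<Sum>i\<in>J. \<Sum>j\<in>J. \<integral>\<omega>. u i \<omega> \<bullet> u j \<omega> \<partial>M)"
    using sq by (simp add: integrable_inner_square_integrable)
  also have "\<dots> = (\<Sum>i\<in>J. \<Sum>j\<in>J. if j = i then \<integral>\<omega>. (norm (u i \<omega>))\<^sup>2 \<partial>M else 0)"
    using orth by (intro sum.cong) (auto simp: power2_norm_eq_inner)
  also have "\<dots> = (\<Sum>i\<in>J. \<integral>\<omega>. (norm (u i \<omega>))\<^sup>2 \<partial>M)"
    using J by simp
  also have "\<dots> \<le> ?n * s"
    using sum_bounded_above[of J "\<lambda>i. \<integral>\<omega>. (norm (u i \<omega>))\<^sup>2 \<partial>M" s] le by simp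
  finally have "(1 / ?n)\<^sup>2 * (\<integral>\<omega>. (norm (\<Sum>j\<in>J. u j \<omega>))\<^sup>2 \<partial>M) \<le> (1 / ?n)\<^sup>2 * (?n * s)"
    by (intro mult_left_mono) auto
  then show ?thesis
    using n by (simp add: power_mult_distrib power2_eq_square)
qed

section \<open>The iterates as functions of the samples\<close>

text \<open>The state after \<open>k\<close> steps is the pair \<open>(x\<^sub>k, x\<^sub>k\<^sub>-\<^sub>1)\<close>, with \<open>x\<^sub>-\<^sub>1 = x\<^sub>0\<close>.\<close>

primrec heavy_ball ::
  "real \<Rightarrow> real \<Rightarrow> (nat \<Rightarrow> 'a \<Rightarrow> 'a) \<Rightarrow> 'a \<Rightarrow> nat \<Rightarrow> 'a \<times> 'a::real_vector" where
  "heavy_ball \<alpha> \<beta> h x0 0 = (x0, x0)"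
| "heavy_ball \<alpha> \<beta> h x0 (Suc k) =
    (fst (heavy_ball \<alpha> \<beta> h x0 k) - \<alpha> *\<^sub>R h k (fst (heavy_ball \<alpha> \<beta> h x0 k))
       + \<beta> *\<^sub>R (fst (heavy_ball \<alpha> \<beta> h x0 k) - snd (heavy_ball \<alpha> \<beta> h x0 k)),
     fst (heavy_ball \<alpha> \<beta> h x0 k))"

text \<open>Samples form one family over pairs (position, iteration), the index set of the
  independence assumption, so that iterates can also be evaluated at points of a product
  space.\<close>

definition minibatch ::
  "('a \<Rightarrow> 'b \<Rightarrow> 'a::real_vector) \<Rightarrow> (nat \<Rightarrow> nat) \<Rightarrow> (nat \<times> nat \<Rightarrow> 'b) \<Rightarrow> nat \<Rightarrow> 'a \<Rightarrow> 'a" where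
  "minibatch G N s k y = (1 / real (N k)) *\<^sub>R (\<Sum>j=1..N k. G y (s (j, k)))"

lemma heavy_ball_eqI:
  assumes "x 0 = x0"
    and "\<And>k. x (Suc k) = x k - \<alpha> *\<^sub>R h k (x k) + \<beta> *\<^sub>R (x k - x (k - 1))"
  shows "heavy_ball \<alpha> \<beta> h x0 k = (x k, x (k - 1))"
  by (induction k) (simp_all add: assms)

text \<open>Allows the sample family to be restricted to earlier iterations.\<close>

lemma heavy_ball_cong:
  assumes "\<And>t y. t < k \<Longrightarrow> h t y = h' t y"
  shows "heavy_ball \<alpha> \<beta> h x0 k = heavy_ball \<alpha> \<beta> h' x0 k"
  using assms by (induction k) simp_all

text \<open>The sample map and its source are general in order to cover both the product space of
  samples and the sample space with the history.\<close>

lemma measurable_heavy_ball_minibatch: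
  fixes G :: "'a::euclidean_space \<Rightarrow> 'b \<Rightarrow> 'a"
  assumes G: "(\<lambda>(y, z). G y z) \<in> borel_measurable (borel \<Otimes>\<^sub>M S)"
    and s: "\<And>j t. t < k \<Longrightarrow> j \<in> {1..N t} \<Longrightarrow> (\<lambda>\<omega>. s \<omega> (j, t)) \<in> A \<rightarrow>\<^sub>M S"
  shows "(\<lambda>\<omega>. heavy_ball \<alpha> \<beta> (minibatch G N (s \<omega>)) x0 k) \<in> A \<rightarrow>\<^sub>M borel \<Otimes>\<^sub>M borel"
  using s
proof (induction k)
  case (Suc k)
  let ?H = "\<lambda>\<omega>. heavy_ball \<alpha> \<beta> (minibatch G N (s \<omega>)) x0 k"
  have [measurable]: "?H \<in> A \<rightarrow>\<^sub>M borel \<Otimes>\<^sub>M borel"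
    using Suc by simp
  have "(\<lambda>\<omega>. G (fst (?H \<omega>)) (s \<omega> (j, k))) \<in> borel_measurable A" if "j \<in> {1..N k}" for j
  proof -
    have [measurable]: "(\<lambda>\<omega>. s \<omega> (j, k)) \<in> A \<rightarrow>\<^sub>M S"
      using Suc.prems that by simp
    show ?thesis
      using measurable_compose[OF _ G, of "\<lambda>\<omega>. (fst (?H \<omega>), s \<omega> (j, k))"] by simp
  qed
  then have [measurable]: "(\<lambda>\<omega>. minibatch G N (s \<omega>) k (fst (?H \<omega>))) \<in> borel_measurable A"
    unfolding minibatch_def by (intro borel_measurable_scaleR borel_measurable_const borel_measurable_sum)
  show ?case by simp
qed simp

text \<open>Being centered on events of the iterate does not by itself make two noise terms of one
  batch uncorrelated. Independence of \<open>\<xi> j k\<close> from the past together with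
  \<open>\<xi> i k\<close> does: averaged over its own sample, the \<open>j\<close>-th noise
  vanishes at almost every value of the iterate.\<close>

lemma (in prob_space) minibatch_noise_uncorrelated:
  fixes G :: "'b::euclidean_space \<Rightarrow> 'c \<Rightarrow> 'b"
  assumes ind: "indep_vars (\<lambda>_. S) (\<lambda>(j, k). \<xi> j k) {(j, k). j \<in> {1..N k}}"
    and G: "(\<lambda>(y, z). G y z) \<in> borel_measurable (borel \<Otimes>\<^sub>M S)"
    and g [measurable]: "g \<in> borel_measurable borel"
    and X: "\<And>\<omega>. \<omega> \<in> space M \<Longrightarrow> X \<omega> = fst (heavy_ball \<alpha> \<beta> (minibatch G N (\<lambda>(j, t). \<xi> j t \<omega>)) x0 k)"
    and ij: "i \<in> {1..N k}" "j \<in> {1..N k}" "i \<noteq> j"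
    and sq: "\<And>i. i \<in> {1..N k} \<Longrightarrow> square_integrable M (\<lambda>\<omega>. G (X \<omega>) (\<xi> i k \<omega>) - g (X \<omega>))"
    and centered: "\<And>B b. B \<in> sets borel \<Longrightarrow> b \<in> Basis \<Longrightarrow>
      expectation (\<lambda>\<omega>. indicator B (X \<omega>) * ((G (X \<omega>) (\<xi> j k \<omega>) - g (X \<omega>)) \<bullet> b)) = 0"
  shows "expectation (\<lambda>\<omega>. (G (X \<omega>) (\<xi> i k \<omega>) - g (X \<omega>)) \<bullet> (G (X \<omega>) (\<xi> j k \<omega>) - g (X \<omega>))) = 0"
proof -
  \<comment> \<open>\<open>W\<close> collects the past samples and the \<open>i\<close>-th current one, so it determines \<open>X\<close> and the
    \<open>i\<close>-th noise term and is independent of \<open>\<xi> j k\<close>.\<close>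
  define A where "A = {(j, t). j \<in> {1..N t} \<and> t < k} \<union> {(i, k)}"
  define W where "W \<omega> = restrict (\<lambda>p. (case p of (j, t) \<Rightarrow> \<xi> j t) \<omega>) A" for \<omega>
  let ?R = "PiM A (\<lambda>_. S)"
  define \<phi> where "\<phi> s = fst (heavy_ball \<alpha> \<beta> (minibatch G N s) x0 k)" for s
  \<comment> \<open>\<open>indep_var_restrict\<close> speaks of subfamilies, so the single sample
    becomes a family over one index.\<close>
  define Y where "Y \<omega> = restrict (\<lambda>p. (case p of (j, t) \<Rightarrow> \<xi> j t) \<omega>) {(j, k)}" for \<omega>
  let ?T = "PiM {(j, k)} (\<lambda>_. S)"
  have indWY: "indep_var ?R W ?T Y"
    unfolding W_def Y_def
    by (rule indep_var_restrict[OF ind]) (use ij in \<open>auto simp: A_def\<close>)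
  have Yj: "Y \<omega> (j, k) = \<xi> j k \<omega>" for \<omega>
    by (simp add: Y_def)
  have comp: "(\<lambda>s. s p) \<in> ?R \<rightarrow>\<^sub>M S" if "p \<in> A" for p
    using that by (rule measurable_component_singleton)
  have "(\<lambda>s. heavy_ball \<alpha> \<beta> (minibatch G N s) x0 k) \<in> ?R \<rightarrow>\<^sub>M borel \<Otimes>\<^sub>M borel"
    by (rule measurable_heavy_ball_minibatch[OF G]) (auto intro!: comp simp: A_def)
  then have \<phi> [measurable]: "\<phi> \<in> ?R \<rightarrow>\<^sub>M borel"
    unfolding \<phi>_def by (rule measurable_compose) simp
  have [measurable]: "(\<lambda>s. s (i, k)) \<in> ?R \<rightarrow>\<^sub>M S"
    by (rule comp) (simp add: A_def)
  \<comment> \<open>The iterate reads only samples from before iteration \<open>k\<close>, all of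
    which survive the restriction to \<open>A\<close>.\<close>
  have \<phi>W: "\<phi> (W \<omega>) = X \<omega>" if "\<omega> \<in> space M" for \<omega>
    unfolding \<phi>_def X[OF that]
    by (rule arg_cong[where f = fst], rule heavy_ball_cong)
      (auto simp: minibatch_def W_def A_def intro!: arg_cong[where f = "scaleR _"] sum.cong)
  have Wi: "W \<omega> (i, k) = \<xi> i k \<omega>" for \<omega>
    by (simp add: W_def A_def)
  let ?u = "\<lambda>i \<omega>. G (X \<omega>) (\<xi> i k \<omega>) - g (X \<omega>)"
  have sq_b: "square_integrable M (\<lambda>\<omega>. ?u i \<omega> \<bullet> b)" if "i \<in> {1..N k}" "b \<in> Basis" for i b
    by (rule square_integrable_bound[OF sq[OF that(1)], where C = 1])
      (use sq[OF that(1)] that in \<open>auto simp: square_integrable_def Basis_le_norm\<close>)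
  have int_b: "integrable M (\<lambda>\<omega>. (?u i \<omega> \<bullet> b) * (?u j \<omega> \<bullet> b))" if "b \<in> Basis" for b
    using integrable_inner_square_integrable[OF sq_b[OF ij(1) that] sq_b[OF ij(2) that]] by simp
  \<comment> \<open>Coordinatewise, the \<open>j\<close>-th noise is a function of the iterate and
    the fresh sample, and the \<open>i\<close>-th is a weight depending on \<open>W\<close>
    alone.\<close>
  have zero: "expectation (\<lambda>\<omega>. (?u i \<omega> \<bullet> b) * (?u j \<omega> \<bullet> b)) = 0" if b: "b \<in> Basis" for b
  proof -
    let ?h = "\<lambda>p. (G (fst p) (snd p (j, k)) - g (fst p)) \<bullet> b"
    let ?l = "\<lambda>s. (G (\<phi> s) (s (i, k)) - g (\<phi> s)) \<bullet> b"
    have "expectation (\<lambda>\<omega>. ?l (W \<omega>) * ?h (\<phi> (W \<omega>), Y \<omega>)) = 0"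
    proof (rule expectation_mult_centered_indep[OF indWY \<phi>])
      have "(\<lambda>p. snd p (j, k)) \<in> borel \<Otimes>\<^sub>M ?T \<rightarrow>\<^sub>M S"
        by (rule measurable_compose[OF measurable_snd]) (rule measurable_component_singleton, simp)
      then have "(\<lambda>p. (fst p, snd p (j, k))) \<in> borel \<Otimes>\<^sub>M ?T \<rightarrow>\<^sub>M borel \<Otimes>\<^sub>M S"
        by measurable
      from measurable_compose[OF this G]
      have "(\<lambda>p. G (fst p) (snd p (j, k))) \<in> borel_measurable (borel \<Otimes>\<^sub>M ?T)"
        by simp
      then show "?h \<in> borel_measurable (borel \<Otimes>\<^sub>M ?T)"
        by measurable
      show "integrable M (\<lambda>\<omega>. ?h (\<phi> (W \<omega>), Y \<omega>))"
        using square_integrable_integrable_inner[OF sq[OF ij(2)], of b]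
        by (simp add: \<phi>W Yj cong: Bochner_Integration.integrable_cong)
      show "expectation (\<lambda>\<omega>. indicator B (\<phi> (W \<omega>)) * ?h (\<phi> (W \<omega>), Y \<omega>)) = 0"
        if "B \<in> sets borel" for B
        using centered[OF that b] by (simp add: \<phi>W Yj cong: Bochner_Integration.integral_cong)
      have "(\<lambda>s. G (\<phi> s) (s (i, k))) \<in> borel_measurable ?R"
        using measurable_compose[OF _ G, of "\<lambda>s. (\<phi> s, s (i, k))"] by simp
      then show "?l \<in> borel_measurable ?R"
        by measurable
      show "integrable M (\<lambda>\<omega>. ?l (W \<omega>) * ?h (\<phi> (W \<omega>), Y \<omega>))"
        using int_b[OF b] by (simp add: \<phi>W Wi Yj cong: Bochner_Integration.integrable_cong)
    qed
    then show ?thesis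
      by (simp add: \<phi>W Wi Yj cong: Bochner_Integration.integral_cong)
  qed
  show ?thesis
    by (subst euclidean_inner) (simp add: int_b zero)
qed

section \<open>Mean-square rate of the iterates\<close>

theorem proposition8:
  fixes M :: "'w measure"
    and F :: "real ^ 'm \<Rightarrow> real ^ 'd \<Rightarrow> real"
    and \<xi>0 :: "'w \<Rightarrow> real ^ 'd"
    and \<xi> :: "nat \<Rightarrow> nat \<Rightarrow> 'w \<Rightarrow> real ^ 'd"
    and f :: "real ^ 'm \<Rightarrow> real"
    and x :: "nat \<Rightarrow> 'w \<Rightarrow> real ^ 'm"
    and w :: "nat \<Rightarrow> 'w \<Rightarrow> real ^ 'm"
    and x0 xstar :: "real ^ 'm"
    and N :: "nat \<Rightarrow> nat"
    and L \<eta> \<nu> \<alpha> \<beta> v :: real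
  assumes "prob_space M"
    and "\<xi>0 \<in> borel_measurable M"
    and "\<And>y. F y \<in> borel_measurable borel"
    and "\<And>y z. (\<lambda>u. F u z) differentiable (at y)"
    and "\<And>y. integrable M (\<lambda>\<omega>. F y (\<xi>0 \<omega>))"
    and "\<And>y. f y = (\<integral>\<omega>. F y (\<xi>0 \<omega>) \<partial>M)"
    and "prob_space.indep_vars M (\<lambda>_. borel) (\<lambda>(j, k). \<xi> j k) {(j, k). j \<in> {1..N k}}"
    and "\<And>j k. j \<in> {1..N k} \<Longrightarrow> distr M borel (\<xi> j k) = distr M borel \<xi>0"
    and "\<And>y. f differentiable (at y)"
    and "continuous_on UNIV (gradient f)"
    and "L > 0"
    and "\<And>y y'. norm (gradient f y - gradient f y') \<le> L * norm (y - y')"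
    and "\<eta> > 0"
    and "\<And>y y'. (gradient f y - gradient f y') \<bullet> (y - y') \<ge> \<eta> * (norm (y - y'))\<^sup>2"
    and "\<nu> > 0"
    and "\<And>k j. j \<in> {1..N k} \<Longrightarrow> AE \<omega> in M.
           vec_cond_exp M (history M (x 0) \<xi> N k)
             (\<lambda>\<omega>. gradient (\<lambda>u. F u (\<xi> j k \<omega>)) (x k \<omega>)) \<omega> = gradient f (x k \<omega>)"
    and "\<And>k j. j \<in> {1..N k} \<Longrightarrow> AE \<omega> in M.
           nn_cond_exp M (history M (x 0) \<xi> N k)
             (\<lambda>\<omega>. ennreal ((norm (gradient (\<lambda>u. F u (\<xi> j k \<omega>)) (x k \<omega>)
                                    - gradient f (x k \<omega>)))\<^sup>2)) \<omega> \<le> ennreal (\<nu>\<^sup>2)"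
    and "\<And>y. f xstar \<le> f y"
    and "\<beta> \<in> {0<..<1}"
    and "\<alpha> \<in> {0<..<2 * (1 - \<beta>) / (L + \<eta>)}"
    and "v > 0"
    and "\<And>k. N k = nat \<lceil>(real k + 1) powr v\<rceil>"
    and "\<And>k \<omega>. \<omega> \<in> space M \<Longrightarrow>
           w k \<omega> = (1 / real (N k)) *\<^sub>R (\<Sum>j=1..N k. gradient (\<lambda>u. F u (\<xi> j k \<omega>)) (x k \<omega>))
                   - gradient f (x k \<omega>)"
    and "\<And>\<omega>. \<omega> \<in> space M \<Longrightarrow> x 0 \<omega> = x0"
    \<comment> \<open>truncated subtraction makes \<open>x (0 - 1) = x 0\<close>, the convention at \<open>k = 0\<close>\<close>
    and "\<And>k \<omega>. \<omega> \<in> space M \<Longrightarrow>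
           x (Suc k) \<omega> = x k \<omega> - \<alpha> *\<^sub>R (gradient f (x k \<omega>) + w k \<omega>)
                          + \<beta> *\<^sub>R (x k \<omega> - x (k - 1) \<omega>)"
  shows "\<exists>C>0. \<forall>k. integrable M (\<lambda>\<omega>. (norm (x k \<omega> - xstar))\<^sup>2) \<and>
           (\<integral>\<omega>. (norm (x k \<omega> - xstar))\<^sup>2 \<partial>M) \<le> C * (real k + 1) powr (- v)"
proof -
  note diff_F = assms(4) and ind = assms(7) and diff = assms(9) and L = assms(11) and lip = assms(12)
    and \<eta> = assms(13) and mono = assms(14) and unbiased = assms(16) and variance = assms(17)
    and min = assms(18) and N = assms(22) and w = assms(23) and x_0 = assms(24) and x_Suc = assms(25)
  interpret prob_space M by fact
  define G where "G y z = gradient (\<lambda>u. F u z) y" for y z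
  define u where "u k j \<omega> = G (x k \<omega>) (\<xi> j k \<omega>) - gradient f (x k \<omega>)" for k j \<omega>
  define H where "H k = history M (x 0) \<xi> N k" for k
  have N_pos: "N k > 0" for k
    using powr_gt_zero[of "real k + 1" v] unfolding N by linarith
  have N_ge: "real (N k) \<ge> (real k + 1) powr v" for k
    unfolding N by linarith

  have G_meas: "(\<lambda>(y, z). G y z) \<in> borel_measurable (borel \<Otimes>\<^sub>M borel)"
    unfolding G_def by (rule borel_measurable_gradient[OF assms(3) diff_F])
  have g_meas [measurable]: "gradient f \<in> borel_measurable borel"
    using assms(10) by (rule borel_measurable_continuous_onI)
  have \<xi>_meas: "\<xi> j k \<in> borel_measurable M" if "j \<in> {1..N k}" for j k
    using ind that by (auto simp: indep_vars_def)

  \<comment> \<open>Writing the process as a function of the samples is what yields its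
    measurability and the independence argument.\<close>
  have x_eq: "heavy_ball \<alpha> \<beta> (minibatch G N (\<lambda>(j, t). \<xi> j t \<omega>)) x0 k = (x k \<omega>, x (k - 1) \<omega>)"
    if "\<omega> \<in> space M" for \<omega> k
  proof (rule heavy_ball_eqI)
    show "x (Suc k) \<omega> = x k \<omega> - \<alpha> *\<^sub>R minibatch G N (\<lambda>(j, t). \<xi> j t \<omega>) k (x k \<omega>)
        + \<beta> *\<^sub>R (x k \<omega> - x (k - 1) \<omega>)" for k
      using x_Suc[OF that, of k] w[OF that, of k] by (simp add: minibatch_def G_def)
  qed (rule x_0[OF that])

  have gen: "{x 0 -` B \<inter> space M | B. B \<in> sets borel} \<union>
      {\<xi> j t -` B \<inter> space M | j t B. j \<in> {1..N t} \<and> t < k \<and> B \<in> sets borel} \<subseteq> sets M" for k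
  proof -
    have "x 0 \<in> borel_measurable M"
      using x_0 by (subst measurable_cong[where g = "\<lambda>_. x0"]) auto
    with \<xi>_meas show ?thesis by (auto intro: measurable_sets)
  qed
  then have gen_Pow: "{x 0 -` B \<inter> space M | B. B \<in> sets borel} \<union>
      {\<xi> j t -` B \<inter> space M | j t B. j \<in> {1..N t} \<and> t < k \<and> B \<in> sets borel} \<subseteq> Pow (space M)" for k
    using sets.space_closed[of M] by (rule order_trans)
  have space_H: "space (H k) = space M" for k
    unfolding H_def history_def by (rule space_measure_of[OF gen_Pow])
  have subalg: "subalgebra M (H k)" for k
    unfolding subalgebra_def space_H
    unfolding H_def history_def sets_measure_of[OF gen_Pow]
    by (intro conjI refl sets.sigma_sets_subset gen)
  interpret H: finite_measure_subalgebra M "H k" for k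
    by unfold_locales (rule subalg)
  have \<xi>_H: "\<xi> j t \<in> borel_measurable (H k)" if "j \<in> {1..N t}" "t < k" for j t k
  proof (rule measurableI)
    fix B :: "(real ^ 'd) set" assume "B \<in> sets borel"
    then show "\<xi> j t -` B \<inter> space (H k) \<in> sets (H k)"
      unfolding space_H unfolding H_def history_def sets_measure_of[OF gen_Pow]
      using that by (intro sigma_sets.Basic) blast
  qed simp
  \<comment> \<open>Adaptedness admits indicators of events of \<open>x k\<close> as test functions
    against conditional expectations given \<open>H k\<close>.\<close>
  have x_H: "x k \<in> borel_measurable (H k)" for k
  proof -
    have "(\<lambda>\<omega>. heavy_ball \<alpha> \<beta> (minibatch G N (\<lambda>(j, t). \<xi> j t \<omega>)) x0 k) \<in> H k \<rightarrow>\<^sub>M borel \<Otimes>\<^sub>M borel"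
      by (rule measurable_heavy_ball_minibatch[OF G_meas]) (simp add: \<xi>_H)
    from measurable_compose[OF this measurable_fst]
    show ?thesis
      by (subst measurable_cong[where g = "\<lambda>\<omega>. fst (heavy_ball \<alpha> \<beta> (minibatch G N (\<lambda>(j, t). \<xi> j t \<omega>)) x0 k)"])
        (auto simp: space_H x_eq)
  qed
  have x_meas [measurable]: "x k \<in> borel_measurable M" for k
    using subalg x_H by (rule measurable_from_subalg)
  have Gx_meas: "(\<lambda>\<omega>. G (x k \<omega>) (\<xi> j k \<omega>)) \<in> borel_measurable M" if "j \<in> {1..N k}" for j k
    using measurable_compose[OF measurable_Pair[OF x_meas \<xi>_meas[OF that]] G_meas] by simp
  have u_meas: "u k j \<in> borel_measurable M" if "j \<in> {1..N k}" for j k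
    unfolding u_def using Gx_meas[OF that] by measurable

  \<comment> \<open>\<open>nn_cond_exp\<close> makes sense before integrability is known;
    integrating the conditional bound first shows that the second moment is finite.\<close>
  have u_sq: "square_integrable M (u k j) \<and> (\<integral>\<omega>. (norm (u k j \<omega>))\<^sup>2 \<partial>M) \<le> \<nu>\<^sup>2"
    if j: "j \<in> {1..N k}" for j k
  proof -
    let ?s = "\<lambda>\<omega>. ennreal ((norm (u k j \<omega>))\<^sup>2)"
    have [measurable]: "u k j \<in> borel_measurable M" by (rule u_meas[OF j])
    have "(\<integral>\<^sup>+\<omega>. ?s \<omega> \<partial>M) = (\<integral>\<^sup>+\<omega>. nn_cond_exp M (H k) ?s \<omega> \<partial>M)"
      using H.nn_cond_exp_intg[of "\<lambda>_. 1" k ?s] by simp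
    also have "\<dots> \<le> (\<integral>\<^sup>+\<omega>. ennreal (\<nu>\<^sup>2) \<partial>M)"
      by (rule nn_integral_mono_AE) (use variance[OF j] in \<open>simp add: u_def G_def H_def\<close>)
    also have "\<dots> = ennreal (\<nu>\<^sup>2)"
      by (simp add: emeasure_space_1)
    finally have le: "(\<integral>\<^sup>+\<omega>. ?s \<omega> \<partial>M) \<le> ennreal (\<nu>\<^sup>2)" .
    then have int: "integrable M (\<lambda>\<omega>. (norm (u k j \<omega>))\<^sup>2)"
      by (intro integrableI_bounded) (auto simp: le_less_trans)
    then show ?thesis
      using le by (simp add: square_integrable_def u_meas[OF j] nn_integral_eq_integral)
  qed

  have w_eq: "w k \<omega> = (1 / real (card {1..N k})) *\<^sub>R (\<Sum>j\<in>{1..N k}. u k j \<omega>)" if "\<omega> \<in> space M" for k \<omega>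
    using N_pos[of k] unfolding w[OF that]
    by (simp add: u_def G_def sum_subtractf scaleR_diff_right sum_constant_scaleR del: sum_constant)
  have w_sq: "square_integrable M (w k)" for k
  proof -
    have "square_integrable M (\<lambda>\<omega>. (1 / real (card {1..N k})) *\<^sub>R (\<Sum>j\<in>{1..N k}. u k j \<omega>))"
      using u_sq by (intro square_integrable_scaleR square_integrable_sum) auto
    then show ?thesis
      by (simp add: square_integrable_def w_eq cong: measurable_cong Bochner_Integration.integrable_cong)
  qed

  have gs: "gradient f xstar = 0"
    using diff min by (rule gradient_minimizer_eq_0)
  \<comment> \<open>The gradient is Lipschitz and vanishes at \<open>xstar\<close>, so its norm is
    at most \<open>L\<close> times the distance to \<open>xstar\<close>.\<close>
  have gx_sq: "square_integrable M (\<lambda>\<omega>. gradient f (x k \<omega>))"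
    if "square_integrable M (\<lambda>\<omega>. x k \<omega> - xstar)" for k
    by (rule square_integrable_bound[OF that, where C = L]) (use lip[where y' = xstar] gs in auto)
  \<comment> \<open>The recursion has order two, so the induction carries two consecutive iterates;
    they coincide at \<open>k = 0\<close>.\<close>
  have x_sq': "square_integrable M (x k) \<and> square_integrable M (x (k - 1))" for k
  proof (induction k)
    case 0
    have "square_integrable M (x 0)"
      by (rule square_integrable_bound[OF square_integrable_const[of x0], where C = 1])
        (use x_0 in auto)
    then show ?case by simp
  next
    case (Suc k)
    then have "square_integrable M (\<lambda>\<omega>. x k \<omega> - \<alpha> *\<^sub>R (gradient f (x k \<omega>) + w k \<omega>)
        + \<beta> *\<^sub>R (x k \<omega> - x (k - 1) \<omega>))"
      using w_sq[of k]
      by (intro square_integrable_add square_integrable_diff square_integrable_scaleR gx_sq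
          square_integrable_const) auto
    then have "square_integrable M (x (Suc k))"
      by (rule square_integrable_bound[where C = 1]) (use x_Suc in auto)
    with Suc.IH show ?case by simp
  qed
  have x_sq: "square_integrable M (\<lambda>\<omega>. x k \<omega> - xstar)" for k
    using x_sq'[of k] square_integrable_const[of xstar] by (intro square_integrable_diff) auto
  have p_sq: "square_integrable M (\<lambda>\<omega>. x k \<omega> - x (k - 1) \<omega>)" for k
    using x_sq'[of k] by (intro square_integrable_diff) auto

  have centered: "expectation (\<lambda>\<omega>. indicator B (x k \<omega>) * (u k j \<omega> \<bullet> b)) = 0"
    if j: "j \<in> {1..N k}" and B [measurable]: "B \<in> sets borel" and b: "b \<in> Basis" for j k B b
  proof -
    obtain i where i: "b = axis i 1"
      using b by (auto simp: Basis_vec_def)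
    let ?G = "\<lambda>\<omega>. G (x k \<omega>) (\<xi> j k \<omega>) $ i" and ?g = "\<lambda>\<omega>. gradient f (x k \<omega>) $ i"
    let ?I = "\<lambda>\<omega>. indicator B (x k \<omega>) :: real"
    have [measurable]: "?G \<in> borel_measurable M"
      using measurable_compose[OF Gx_meas[OF j], of "\<lambda>z. z $ i" borel] by simp
    have u_i: "u k j \<omega> \<bullet> b = ?G \<omega> - ?g \<omega>" for \<omega>
      by (simp add: u_def i inner_axis)
    have int_u: "integrable M (\<lambda>\<omega>. u k j \<omega> \<bullet> b)"
      using u_sq[OF j] by (intro square_integrable_integrable_inner) simp
    have int_g: "integrable M ?g"
      using square_integrable_integrable_inner[OF gx_sq[OF x_sq], of k b] by (simp add: i inner_axis)
    \<comment> \<open>The defining identity of \<open>real_cond_exp\<close> needs an integrable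
      function; the sampled gradient is the noise plus the true gradient, both integrable.\<close>
    have int_G: "integrable M ?G"
      using Bochner_Integration.integrable_add[OF int_u int_g] by (simp add: u_i)
    have bound: "integrable M (\<lambda>\<omega>. ?I \<omega> * h \<omega>)" if "integrable M h" for h :: "'w \<Rightarrow> real"
      by (rule Bochner_Integration.integrable_bound[OF that])
        (use that in \<open>auto simp: indicator_def\<close>)
    have "?I \<in> borel_measurable (H k)"
      by (rule measurable_compose[OF x_H borel_measurable_indicator[OF B]])
    then have "expectation (\<lambda>\<omega>. ?I \<omega> * ?G \<omega>) = expectation (\<lambda>\<omega>. ?I \<omega> * real_cond_exp M (H k) ?G \<omega>)"
      by (intro H.real_cond_exp_intg(2)[symmetric] bound int_G) auto
    also have "\<dots> = expectation (\<lambda>\<omega>. ?I \<omega> * ?g \<omega>)"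
    proof (rule integral_cong_AE)
      show "AE \<omega> in M. ?I \<omega> * real_cond_exp M (H k) ?G \<omega> = ?I \<omega> * ?g \<omega>"
        using unbiased[OF j] by eventually_elim (auto simp: vec_cond_exp_def vec_eq_iff G_def H_def)
    qed (use int_g in \<open>auto intro!: borel_measurable_times borel_measurable_integrable\<close>)
    finally show ?thesis
      using bound[OF int_G] bound[OF int_g] by (simp add: u_i right_diff_distrib)
  qed

  have w_le: "(\<integral>\<omega>. (norm (w k \<omega>))\<^sup>2 \<partial>M) \<le> \<nu>\<^sup>2 * (real k + 1) powr (- v)" for k
  proof -
    have "(\<integral>\<omega>. (norm (w k \<omega>))\<^sup>2 \<partial>M)
        = (\<integral>\<omega>. (norm ((1 / real (card {1..N k})) *\<^sub>R (\<Sum>j\<in>{1..N k}. u k j \<omega>)))\<^sup>2 \<partial>M)"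
      by (simp only: w_eq cong: Bochner_Integration.integral_cong)
    also have "\<dots> \<le> \<nu>\<^sup>2 / real (card {1..N k})"
    proof (rule second_moment_average_le)
      show "(\<integral>\<omega>. u k i \<omega> \<bullet> u k j \<omega> \<partial>M) = 0" if "i \<in> {1..N k}" "j \<in> {1..N k}" "i \<noteq> j" for i j
        unfolding u_def
      proof (rule minibatch_noise_uncorrelated[OF ind G_meas g_meas _ that])
        show "x k \<omega> = fst (heavy_ball \<alpha> \<beta> (minibatch G N (\<lambda>(j, t). \<xi> j t \<omega>)) x0 k)"
          if "\<omega> \<in> space M" for \<omega>
          by (simp add: x_eq[OF that])
        show "square_integrable M (\<lambda>\<omega>. G (x k \<omega>) (\<xi> i k \<omega>) - gradient f (x k \<omega>))"
          if "i \<in> {1..N k}" for i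
          using u_sq[OF that] unfolding u_def by blast
      qed (use centered[OF that(2)] in \<open>simp add: u_def\<close>)
    qed (use u_sq N_pos in \<open>auto simp: Suc_le_eq\<close>)
    \<comment> \<open>Rounding the batch size up only lowers the variance bound.\<close>
    also have "\<dots> \<le> \<nu>\<^sup>2 / (real k + 1) powr v"
      using N_ge[of k] N_pos[of k] by (simp add: frac_le)
    finally show ?thesis by (simp add: powr_minus divide_inverse)
  qed

  \<comment> \<open>The form of the step size bound that the Lyapunov lemma takes.\<close>
  have "\<alpha> < 2 * (1 - \<beta>) / L"
  proof -
    have "2 * (1 - \<beta>) / (L + \<eta>) \<le> 2 * (1 - \<beta>) / L"
      using L \<eta> assms(19) by (intro divide_left_mono) auto
    then show ?thesis using assms(20) by simp
  qed
  then obtain c q K where c: "c > 0" and q: "0 < q" "q < 1" and K: "K \<ge> 0"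
    and step: "\<And>y p e d. d = \<beta> *\<^sub>R p - \<alpha> *\<^sub>R (gradient f y + e) \<Longrightarrow>
      f (y + d) - f xstar + c * (norm d)\<^sup>2 \<le> q * (f y - f xstar + c * (norm p)\<^sup>2) + K * (norm e)\<^sup>2"
    using heavy_ball_lyapunov_step[OF diff L lip \<eta> mono min, of \<beta> \<alpha>] assms(19,20) by auto
  define V where "V k \<omega> = f (x k \<omega>) - f xstar + c * (norm (x k \<omega> - x (k - 1) \<omega>))\<^sup>2" for k \<omega>
  \<comment> \<open>The lower bound returns from \<open>V\<close> to the distance at the end; the
    upper bound gives integrability of \<open>V\<close>.\<close>
  have f_lower: "\<eta> / 2 * (norm (y - xstar))\<^sup>2 \<le> f y - f xstar" for y
    using strongly_monotone_gradient_lower_bound[OF diff mono, of xstar "y - xstar"] gs by simp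
  have f_upper: "f y - f xstar \<le> L / 2 * (norm (y - xstar))\<^sup>2" for y
    using descent_lemma[OF diff lip, of xstar "y - xstar"] gs by simp
  have f_meas [measurable]: "f \<in> borel_measurable borel"
    by (intro borel_measurable_continuous_onI continuous_at_imp_continuous_on ballI
        differentiable_imp_continuous_within diff)
  have V_int: "integrable M (V k)" for k
  proof -
    have "integrable M (\<lambda>\<omega>. L / 2 * (norm (x k \<omega> - xstar))\<^sup>2)"
      using x_sq[of k] by (simp add: square_integrable_def)
    then have "integrable M (\<lambda>\<omega>. f (x k \<omega>) - f xstar)"
      by (rule Bochner_Integration.integrable_bound) (use f_upper min L in \<open>auto intro!: AE_I2\<close>)
    then show ?thesis
      using p_sq[of k] unfolding V_def square_integrable_def
      by (intro Bochner_Integration.integrable_add integrable_mult_right) auto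
  qed
  have V_nonneg: "0 \<le> V k \<omega>" for k \<omega>
    using min c by (simp add: V_def)
  have "expectation (V (Suc k)) \<le> q * expectation (V k) + K * \<nu>\<^sup>2 * (real k + 1) powr (- v)" for k
  proof -
    have w_int: "integrable M (\<lambda>\<omega>. (norm (w k \<omega>))\<^sup>2)"
      using w_sq[of k] by (simp add: square_integrable_def)
    have "expectation (V (Suc k)) \<le> (\<integral>\<omega>. q * V k \<omega> + K * (norm (w k \<omega>))\<^sup>2 \<partial>M)"
    proof (rule integral_mono)
      fix \<omega> assume \<omega>: "\<omega> \<in> space M"
      \<comment> \<open>The update as a relation between increments, with noise
        \<open>w k \<omega>\<close>.\<close>
      have "x (Suc k) \<omega> - x k \<omega> = \<beta> *\<^sub>R (x k \<omega> - x (k - 1) \<omega>) - \<alpha> *\<^sub>R (gradient f (x k \<omega>) + w k \<omega>)"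
        using x_Suc[OF \<omega>, of k] by simp
      from step[OF this] show "V (Suc k) \<omega> \<le> q * V k \<omega> + K * (norm (w k \<omega>))\<^sup>2"
        by (simp add: V_def)
    qed (use V_int w_int in auto)
    also have "\<dots> = q * expectation (V k) + K * (\<integral>\<omega>. (norm (w k \<omega>))\<^sup>2 \<partial>M)"
      using V_int w_int by simp
    also have "\<dots> \<le> q * expectation (V k) + K * (\<nu>\<^sup>2 * (real k + 1) powr (- v))"
      using w_le K by (intro add_left_mono mult_left_mono)
    finally show ?thesis by (simp add: mult.assoc)
  qed
  moreover have "expectation (V k) \<ge> 0" for k
    by (rule Bochner_Integration.integral_nonneg) (rule V_nonneg)
  ultimately obtain C where C: "C > 0" "\<And>k. expectation (V k) \<le> C * (real k + 1) powr (- v)"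
    using contraction_powr_perturbation[of "\<lambda>k. expectation (V k)" q "K * \<nu>\<^sup>2" v] q K by auto
  show ?thesis
  proof (intro exI conjI allI)
    \<comment> \<open>By \<open>f_lower\<close>, the squared distance is at most
      \<open>2 / \<eta>\<close> times \<open>V\<close>.\<close>
    show "2 / \<eta> * C > 0"
      using C \<eta> by simp
    fix k
    \<comment> \<open>Without integrability the Bochner integral would be 0 and the bound would say
      nothing.\<close>
    show int: "integrable M (\<lambda>\<omega>. (norm (x k \<omega> - xstar))\<^sup>2)"
      using x_sq[of k] by (simp add: square_integrable_def)
    have "(\<integral>\<omega>. (norm (x k \<omega> - xstar))\<^sup>2 \<partial>M) \<le> (\<integral>\<omega>. 2 / \<eta> * V k \<omega> \<partial>M)"
    proof (rule integral_mono)
      fix \<omega>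
      have "\<eta> / 2 * (norm (x k \<omega> - xstar))\<^sup>2 \<le> V k \<omega>"
        unfolding V_def by (intro order_trans[OF f_lower]) (use c in simp)
      then show "(norm (x k \<omega> - xstar))\<^sup>2 \<le> 2 / \<eta> * V k \<omega>"
        using \<eta> by (simp add: field_simps)
    qed (use int V_int in auto)
    also have "\<dots> \<le> 2 / \<eta> * (C * (real k + 1) powr (- v))"
      using mult_left_mono[OF C(2)[of k], of "2 / \<eta>"] \<eta> by simp
    finally show "(\<integral>\<omega>. (norm (x k \<omega> - xstar))\<^sup>2 \<partial>M) \<le> 2 / \<eta> * C * (real k + 1) powr (- v)"
      by (simp add: mult.assoc)
  qed
qed

end
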